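(* For all $\rho\in\mathcal P(S)$ and $\pi,\pi'\in\Pi_\mu$, $$V^{\pi}_\tau(\rho)-V^{\pi'}_\tau(\rho)=\frac{1}{1-\gamma}\int_S\bigg[\int_A\Big(Q^{\pi'}_\tau(s,a)+\tau\ln\frac{\mathrm d\pi'}{\mathrm d\mu}(a|s)\Big)(\pi-\pi')(da|s)+\tau\,\mathrm{KL}(\pi(\cdot|s)|\pi'(\cdot|s))\bigg]d^{\pi}_\rho(ds).$$
   Context: $S,A$ are Polish spaces (with Borel $\sigma$-algebras), $P$ is a probability kernel from $S\times A$ to $S$ (written $P(ds'|s,a)$), $c:S\times A\to\mathbb R$ is bounded measurable, $\gamma\in[0,1)$, $\mu\in\mathcal P(A)$ is a reference probability measure, $\tau\in(0,\infty)$. $\mathcal P(E)$ denotes Borel probability measures on $E$ and $B_b(E)$ bounded measurable real functions with the sup norm. $\mathrm{KL}(m|m')=\int\ln\frac{\mathrm dm}{\mathrm dm'}\,dm$ if $m\ll m'$, and $+\infty$ otherwise. For $f\in B_b(S\times A)$ put $\boldsymbol\pi(f)(da|s)=\frac{e^{f(s,a)}}{\int_A e^{f(s,a')}\mu(da')}\mu(da)$, and $\Pi_\mu=\{\boldsymbol\pi(f): f\in B_b(S\times A)\}$, a set of probability kernels from $S$ to $A$. For $\pi\in\Pi_\mu$, $\frac{\mathrm d\pi}{\mathrm d\mu}(a|s)$ is the density of $\pi(\cdot|s)$ with respect to $\mu$ (for $\pi=\boldsymbol\pi(f)$ it is $e^{f(s,a)}/\int_A e^{f(s,a')}\mu(da')$).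 For $\pi\in\Pi_\mu$, let $\mathbb E^\pi_s$ be expectation for the controlled process with $s_0=s$, $a_n\sim\pi(\cdot|s_n)$, $s_{n+1}\sim P(\cdot|s_n,a_n)$. Define $V^\pi_\tau(s)=\mathbb E^\pi_s\big[\sum_{n\ge0}\gamma^n\big(c(s_n,a_n)+\tau\,\mathrm{KL}(\pi(\cdot|s_n)|\mu)\big)\big]$, $Q^\pi_\tau(s,a)=c(s,a)+\gamma\int_S V^\pi_\tau(s')P(ds'|s,a)$, $V^\pi_\tau(\rho)=\int_S V^\pi_\tau(s)\rho(ds)$. With $P_\pi(ds'|s)=\int_A P(ds'|s,a)\pi(da|s)$ and $P^n_\pi$ its $n$-fold product ($P^0_\pi(\cdot|s)=\delta_s$), the occupancy kernel is $d^\pi(ds'|s)=(1-\gamma)\sum_{n\ge0}\gamma^nP^n_\pi(ds'|s)$, and $d^\pi_\rho(ds)=\int_S d^\pi(ds|s')\rho(ds')$. *)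

theory Defs
  imports "HOL-Probability.Probability"
begin

text \<open>
  Polish spaces are types of class \<open>polish_space\<close> with their Borel sigma-algebra; the Borel
  sigma-algebra of a product of two such spaces is the product sigma-algebra (\<open>borel_prod\<close>).
  A probability kernel from \<open>M\<close> to \<open>N\<close> is an element of \<open>M \<rightarrow>\<^sub>M prob_algebra N\<close>.
\<close>

section \<open>Relative entropy\<close>

text \<open>
  The library writes the reference measure first: \<open>absolutely_continuous m' m\<close> means
  \<open>m \<lless> m'\<close>, and \<open>entropy_density (exp 1) m' m\<close> is \<open>ln (dm / dm')\<close>. For probability measures
  the negative part of this function is always \<open>m\<close>-integrable, so failure of integrability means
  that the integral is \<open>\<infinity>\<close>.
\<close>

definition KL :: "'a measure \<Rightarrow> 'a measure \<Rightarrow> ereal" where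
  "KL m m' =
    (if absolutely_continuous m' m \<and> integrable m (entropy_density (exp 1) m' m)
     then ereal (KL_divergence (exp 1) m' m) else \<infinity>)"

section \<open>Policies\<close>

definition gibbs_density :: "'a measure \<Rightarrow> ('s \<times> 'a \<Rightarrow> real) \<Rightarrow> 's \<Rightarrow> 'a \<Rightarrow> real" where
  "gibbs_density \<mu> f s a = exp (f (s, a)) / (\<integral>a'. exp (f (s, a')) \<partial>\<mu>)"

definition gibbs_policy :: "'a measure \<Rightarrow> ('s \<times> 'a \<Rightarrow> real) \<Rightarrow> 's \<Rightarrow> 'a measure" where
  "gibbs_policy \<mu> f s = density \<mu> (\<lambda>a. ennreal (gibbs_density \<mu> f s a))"

definition gibbs_policies ::
    "'a::polish_space measure \<Rightarrow> ('s::polish_space \<Rightarrow> 'a measure) set" where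
  "gibbs_policies \<mu> =
    {gibbs_policy \<mu> f | f. f \<in> borel_measurable (borel \<Otimes>\<^sub>M borel) \<and> bounded (range f)}"

definition policy_density :: "'a measure \<Rightarrow> ('s \<Rightarrow> 'a measure) \<Rightarrow> 's \<Rightarrow> 'a \<Rightarrow> real" where
  "policy_density \<mu> \<pi> s a = enn2real (RN_deriv \<mu> (\<pi> s) a)"

section \<open>The controlled process\<close>

text \<open>
  Trajectories are sequences of state-action pairs \<open>\<omega> n = (s\<^sub>n, a\<^sub>n)\<close>. The law of the next pair given
  the past is the first argument of the Ionescu-Tulcea construction; the projective limit
  is the unique measure on the sequence space with these conditional laws.
\<close>

definition step_kernel ::
    "('s::polish_space \<times> 'a::polish_space \<Rightarrow> 's measure) \<Rightarrow> ('s \<Rightarrow> 'a measure) \<Rightarrow> 's \<Rightarrow>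
      nat \<Rightarrow> (nat \<Rightarrow> 's \<times> 'a) \<Rightarrow> ('s \<times> 'a) measure" where
  "step_kernel P \<pi> s n \<omega> =
    (case n of
       0 \<Rightarrow> return borel s
     | Suc k \<Rightarrow> P (\<omega> k)) \<bind> (\<lambda>s'. distr (\<pi> s') (borel \<Otimes>\<^sub>M borel) (Pair s'))"

definition trajectory_measure ::
    "('s::polish_space \<times> 'a::polish_space \<Rightarrow> 's measure) \<Rightarrow> ('s \<Rightarrow> 'a measure) \<Rightarrow> 's \<Rightarrow>
      (nat \<Rightarrow> 's \<times> 'a) measure" where
  "trajectory_measure P \<pi> s =
    projective_family.lim UNIV
      (Ionescu_Tulcea.CI (step_kernel P \<pi> s) (\<lambda>_. borel \<Otimes>\<^sub>M borel)) (\<lambda>_. borel \<Otimes>\<^sub>M borel)"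

section \<open>Value functions\<close>

text \<open>
  The conversion \<open>real_of_ereal\<close> loses nothing for policies in \<open>gibbs_policies \<mu>\<close>:
  see \<open>KL_gibbs_policies_finite\<close> and \<open>KL_gibbs_policies_reference_finite\<close> below.
\<close>

definition reg_value ::
    "('s::polish_space \<times> 'a::polish_space \<Rightarrow> 's measure) \<Rightarrow> ('s \<times> 'a \<Rightarrow> real) \<Rightarrow> real \<Rightarrow> 'a measure \<Rightarrow>
      real \<Rightarrow> ('s \<Rightarrow> 'a measure) \<Rightarrow> 's \<Rightarrow> real" where
  "reg_value P c \<gamma> \<mu> \<tau> \<pi> s =
    (\<integral>\<omega>. (\<Sum>n. \<gamma> ^ n * (c (\<omega> n) + \<tau> * real_of_ereal (KL (\<pi> (fst (\<omega> n))) \<mu>)))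
      \<partial>trajectory_measure P \<pi> s)"

definition reg_Q ::
    "('s::polish_space \<times> 'a::polish_space \<Rightarrow> 's measure) \<Rightarrow> ('s \<times> 'a \<Rightarrow> real) \<Rightarrow> real \<Rightarrow> 'a measure \<Rightarrow>
      real \<Rightarrow> ('s \<Rightarrow> 'a measure) \<Rightarrow> 's \<Rightarrow> 'a \<Rightarrow> real" where
  "reg_Q P c \<gamma> \<mu> \<tau> \<pi> s a = c (s, a) + \<gamma> * (\<integral>s'. reg_value P c \<gamma> \<mu> \<tau> \<pi> s' \<partial>P (s, a))"

definition reg_value_dist ::
    "('s::polish_space \<times> 'a::polish_space \<Rightarrow> 's measure) \<Rightarrow> ('s \<times> 'a \<Rightarrow> real) \<Rightarrow> real \<Rightarrow> 'a measure \<Rightarrow>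
      real \<Rightarrow> ('s \<Rightarrow> 'a measure) \<Rightarrow> 's measure \<Rightarrow> real" where
  "reg_value_dist P c \<gamma> \<mu> \<tau> \<pi> \<rho> = (\<integral>s. reg_value P c \<gamma> \<mu> \<tau> \<pi> s \<partial>\<rho>)"

section \<open>Occupancy measures\<close>

definition state_kernel ::
    "('s \<times> 'a \<Rightarrow> 's measure) \<Rightarrow> ('s \<Rightarrow> 'a measure) \<Rightarrow> 's \<Rightarrow> 's measure" where
  "state_kernel P \<pi> s = \<pi> s \<bind> (\<lambda>a. P (s, a))"

primrec state_kernel_pow ::
    "('s::polish_space \<times> 'a \<Rightarrow> 's measure) \<Rightarrow> ('s \<Rightarrow> 'a measure) \<Rightarrow> nat \<Rightarrow> 's \<Rightarrow> 's measure" where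
  "state_kernel_pow P \<pi> 0 s = return borel s"
| "state_kernel_pow P \<pi> (Suc n) s = state_kernel_pow P \<pi> n s \<bind> state_kernel P \<pi>"

definition occupancy_kernel ::
    "('s::polish_space \<times> 'a \<Rightarrow> 's measure) \<Rightarrow> real \<Rightarrow> ('s \<Rightarrow> 'a measure) \<Rightarrow> 's \<Rightarrow> 's measure" where
  "occupancy_kernel P \<gamma> \<pi> s =
    measure_of UNIV (sets borel)
      (\<lambda>B. ennreal (1 - \<gamma>) * (\<Sum>n. ennreal (\<gamma> ^ n) * emeasure (state_kernel_pow P \<pi> n s) B))"

definition occupancy_measure ::
    "('s::polish_space \<times> 'a \<Rightarrow> 's measure) \<Rightarrow> real \<Rightarrow> ('s \<Rightarrow> 'a measure) \<Rightarrow> 's measure \<Rightarrow> 's measure" where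
  "occupancy_measure P \<gamma> \<pi> \<rho> = \<rho> \<bind> occupancy_kernel P \<gamma> \<pi>"

section \<open>Well-definedness\<close>

text \<open>
  The conversions and library constructions used above are only meaningful under side conditions
  (finiteness, the locale assumptions of \<open>Ionescu_Tulcea\<close>, countable additivity, kernel
  measurability), which are established here.
\<close>

lemma gibbs_bounds:
  fixes \<mu> :: "'a::polish_space measure" and f :: "'s::polish_space \<times> 'a \<Rightarrow> real"
  assumes \<mu>: "\<mu> \<in> space (prob_algebra borel)"
    and f[measurable]: "f \<in> borel_measurable (borel \<Otimes>\<^sub>M borel)"
    and B: "\<And>x. \<bar>f x\<bar> \<le> B"
  shows "integrable \<mu> (\<lambda>a. exp (f (s, a)))"
    and "exp (- B) \<le> (\<integral>a. exp (f (s, a)) \<partial>\<mu>)"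
    and "(\<integral>a. exp (f (s, a)) \<partial>\<mu>) \<le> exp B"
    and "exp (- (2 * B)) \<le> gibbs_density \<mu> f s a"
    and "gibbs_density \<mu> f s a \<le> exp (2 * B)"
proof -
  have [measurable_cong]: "sets \<mu> = sets borel" and "prob_space \<mu>"
    using \<mu> by (auto simp: space_prob_algebra)
  interpret prob_space \<mu> by fact
  have bd: "exp (- B) \<le> exp (f x)" "exp (f x) \<le> exp B" for x
    using B[of x] by (auto simp: abs_le_iff)
  show int: "integrable \<mu> (\<lambda>a. exp (f (s, a)))"
    by (rule integrable_const_bound[where B = "exp B"], rule AE_I2)
      (simp_all add: bd del: exp_le_cancel_iff)
  show lo: "exp (- B) \<le> (\<integral>a. exp (f (s, a)) \<partial>\<mu>)"
    using integral_mono[of \<mu> "\<lambda>_. exp (- B)" "\<lambda>a. exp (f (s, a))"] int bd by (simp add: prob_space)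
  show hi: "(\<integral>a. exp (f (s, a)) \<partial>\<mu>) \<le> exp B"
    using integral_mono[of \<mu> "\<lambda>a. exp (f (s, a))" "\<lambda>_. exp B"] int bd by (simp add: prob_space)
  have pos: "0 < (\<integral>a. exp (f (s, a)) \<partial>\<mu>)"
    using lo by (rule less_le_trans[rotated]) simp
  have "exp (- (2 * B)) = exp (- B) / exp B"
    by (simp flip: exp_diff)
  also have "\<dots> \<le> gibbs_density \<mu> f s a"
    unfolding gibbs_density_def using bd hi pos by (intro frac_le) auto
  finally show "exp (- (2 * B)) \<le> gibbs_density \<mu> f s a" .
  have "gibbs_density \<mu> f s a \<le> exp B / exp (- B)"
    unfolding gibbs_density_def using bd lo by (intro frac_le) auto
  also have "\<dots> = exp (2 * B)"
    by (simp flip: exp_diff)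
  finally show "gibbs_density \<mu> f s a \<le> exp (2 * B)" .
qed

lemma measurable_gibbs_density:
  fixes \<mu> :: "'a::polish_space measure" and f :: "'s::polish_space \<times> 'a \<Rightarrow> real"
  assumes \<mu>: "\<mu> \<in> space (prob_algebra borel)"
    and f[measurable]: "f \<in> borel_measurable (borel \<Otimes>\<^sub>M borel)"
  shows "(\<lambda>(s, a). gibbs_density \<mu> f s a) \<in> borel_measurable (borel \<Otimes>\<^sub>M borel)"
proof -
  have [measurable_cong]: "sets \<mu> = sets borel" and "prob_space \<mu>"
    using \<mu> by (auto simp: space_prob_algebra)
  interpret prob_space \<mu> by fact
  show ?thesis
    unfolding gibbs_density_def by measurable
qed

lemma measurable_gibbs_policy:
  fixes \<mu> :: "'a::polish_space measure" and f :: "'s::polish_space \<times> 'a \<Rightarrow> real"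
  assumes \<mu>: "\<mu> \<in> space (prob_algebra borel)"
    and f[measurable]: "f \<in> borel_measurable (borel \<Otimes>\<^sub>M borel)"
    and B: "\<And>x. \<bar>f x\<bar> \<le> B"
  shows "gibbs_policy \<mu> f \<in> borel \<rightarrow>\<^sub>M prob_algebra borel"
proof -
  have sets_\<mu>[measurable_cong]: "sets \<mu> = sets borel" and "prob_space \<mu>"
    using \<mu> by (auto simp: space_prob_algebra)
  interpret prob_space \<mu> by fact
  note measurable_gibbs_density[OF \<mu> f, measurable]
  have prob: "prob_space (gibbs_policy \<mu> f s)" for s
  proof
    have pos: "0 < (\<integral>a. exp (f (s, a)) \<partial>\<mu>)"
      using gibbs_bounds(2)[OF \<mu> f B] by (rule less_le_trans[rotated]) simp
    have "emeasure (gibbs_policy \<mu> f s) (space (gibbs_policy \<mu> f s))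
        = (\<integral>\<^sup>+a. ennreal (gibbs_density \<mu> f s a) \<partial>\<mu>)"
      by (simp add: gibbs_policy_def emeasure_density cong: nn_integral_cong)
    also have "\<dots> = ennreal (\<integral>a. gibbs_density \<mu> f s a \<partial>\<mu>)"
      using gibbs_bounds(1)[OF \<mu> f B, of s] pos
      by (intro nn_integral_eq_integral) (auto simp: gibbs_density_def)
    also have "(\<integral>a. gibbs_density \<mu> f s a \<partial>\<mu>) = 1"
      using pos by (simp add: gibbs_density_def)
    finally show "emeasure (gibbs_policy \<mu> f s) (space (gibbs_policy \<mu> f s)) = 1" by simp
  qed
  show ?thesis
  proof (rule measurable_prob_algebraI[OF prob], rule measurable_subprob_algebra)
    show "subprob_space (gibbs_policy \<mu> f s)" for s
      using prob by (rule prob_space_imp_subprob_space)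
    show "sets (gibbs_policy \<mu> f s) = sets borel" for s
      by (simp add: gibbs_policy_def sets_\<mu>)
    fix A :: "'a set" assume [measurable]: "A \<in> sets borel"
    have "(\<lambda>s. emeasure (gibbs_policy \<mu> f s) A)
        = (\<lambda>s. \<integral>\<^sup>+a. ennreal (gibbs_density \<mu> f s a) * indicator A a \<partial>\<mu>)"
      by (simp add: gibbs_policy_def emeasure_density sets_\<mu>)
    also have "\<dots> \<in> borel_measurable borel"
      by measurable
    finally show "(\<lambda>s. emeasure (gibbs_policy \<mu> f s) A) \<in> borel_measurable borel" .
  qed
qed

lemma gibbs_policiesE:
  assumes "\<pi> \<in> gibbs_policies \<mu>"
  obtains f B where "\<pi> = gibbs_policy \<mu> f" "f \<in> borel_measurable (borel \<Otimes>\<^sub>M borel)" "\<And>x. \<bar>f x\<bar> \<le> B"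
  using assms unfolding gibbs_policies_def bounded_iff by auto

lemma gibbs_policies_kernel:
  assumes "\<mu> \<in> space (prob_algebra borel)" "\<pi> \<in> gibbs_policies \<mu>"
  shows "\<pi> \<in> borel \<rightarrow>\<^sub>M prob_algebra borel"
  using assms by (metis gibbs_policiesE measurable_gibbs_policy)

lemma policy_density_gibbs_policy:
  fixes \<mu> :: "'a::polish_space measure" and f :: "'s::polish_space \<times> 'a \<Rightarrow> real"
  assumes \<mu>: "\<mu> \<in> space (prob_algebra borel)"
    and f[measurable]: "f \<in> borel_measurable (borel \<Otimes>\<^sub>M borel)"
    and B: "\<And>x. \<bar>f x\<bar> \<le> B"
  shows "AE a in \<mu>. policy_density \<mu> (gibbs_policy \<mu> f) s a = gibbs_density \<mu> f s a"
proof -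
  have sets_\<mu>[measurable_cong]: "sets \<mu> = sets borel" and "prob_space \<mu>"
    using \<mu> by (auto simp: space_prob_algebra)
  interpret prob_space \<mu> by fact
  note measurable_gibbs_density[OF \<mu> f, measurable]
  have nn: "0 \<le> gibbs_density \<mu> f s a" for a
    using gibbs_bounds(4)[OF \<mu> f B, of s a] by (rule order_trans[rotated]) simp
  have "AE a in \<mu>. ennreal (gibbs_density \<mu> f s a) = RN_deriv \<mu> (gibbs_policy \<mu> f s) a"
    by (rule RN_deriv_unique) (auto simp: gibbs_policy_def)
  then show ?thesis
  proof eventually_elim
    case (elim a)
    show ?case
      unfolding policy_density_def elim[symmetric] by (rule enn2real_ennreal[OF nn])
  qed
qed

lemma KL_density_finite:
  assumes "prob_space m'" and h[measurable]: "h \<in> borel_measurable m'"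
    and lo: "\<And>a. exp (- C) \<le> h a" and hi: "\<And>a. h a \<le> exp C"
    and "prob_space (density m' (\<lambda>a. ennreal (h a)))"
  shows "KL (density m' (\<lambda>a. ennreal (h a))) m'
    = ereal (KL_divergence (exp 1) m' (density m' (\<lambda>a. ennreal (h a))))"
proof -
  interpret prob_space m' by fact
  let ?m = "density m' (\<lambda>a. ennreal (h a))"
  interpret m: prob_space ?m by fact
  have pos: "0 < h a" for a
    using lo[of a] by (rule less_le_trans[rotated]) simp
  have ac: "absolutely_continuous m' ?m"
    by (rule absolutely_continuousI_density) simp
  have "AE a in m'. ennreal (h a) = RN_deriv m' ?m a"
    by (rule RN_deriv_unique) auto
  then have "AE a in m'. \<bar>entropy_density (exp 1) m' ?m a\<bar> \<le> C"
  proof eventually_elim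
    fix a assume "ennreal (h a) = RN_deriv m' ?m a"
    then have "entropy_density (exp 1) m' ?m a = ln (h a)"
      using pos[of a] by (simp add: entropy_density_def log_def flip: \<open>ennreal (h a) = _\<close>)
    moreover have "- C \<le> ln (h a)" "ln (h a) \<le> C"
      using ln_mono[OF lo[of a]] ln_mono[OF hi[of a]] pos[of a] by simp_all
    ultimately show "\<bar>entropy_density (exp 1) m' ?m a\<bar> \<le> C" by simp
  qed
  then have "AE a in ?m. norm (entropy_density (exp 1) m' ?m a) \<le> C"
    by (subst AE_density) auto
  then have "integrable ?m (entropy_density (exp 1) m' ?m)"
    by (intro m.integrable_const_bound[where B = C]) auto
  then show ?thesis
    using ac by (simp add: KL_def)
qed

lemma KL_gibbs_policies_finite:
  fixes \<mu> :: "'a::polish_space measure" and \<pi> \<pi>' :: "'s::polish_space \<Rightarrow> 'a measure"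
  assumes \<mu>: "\<mu> \<in> space (prob_algebra borel)"
    and \<pi>: "\<pi> \<in> gibbs_policies \<mu>" and \<pi>': "\<pi>' \<in> gibbs_policies \<mu>"
  shows "KL (\<pi> s) (\<pi>' s) = ereal (KL_divergence (exp 1) (\<pi>' s) (\<pi> s))"
proof -
  have sets_\<mu>[measurable_cong]: "sets \<mu> = sets borel" and "prob_space \<mu>"
    using \<mu> by (auto simp: space_prob_algebra)
  interpret prob_space \<mu> by fact
  obtain f B where f: "\<pi> = gibbs_policy \<mu> f"
    and fm[measurable]: "f \<in> borel_measurable (borel \<Otimes>\<^sub>M borel)" and fB: "\<And>x. \<bar>f x\<bar> \<le> B"
    using gibbs_policiesE[OF \<pi>] by blast
  obtain g D where g: "\<pi>' = gibbs_policy \<mu> g"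
    and gm[measurable]: "g \<in> borel_measurable (borel \<Otimes>\<^sub>M borel)" and gD: "\<And>x. \<bar>g x\<bar> \<le> D"
    using gibbs_policiesE[OF \<pi>'] by blast
  note measurable_gibbs_density[OF \<mu> fm, measurable] measurable_gibbs_density[OF \<mu> gm, measurable]
  note fb = gibbs_bounds(4,5)[OF \<mu> fm fB, of s] and gb = gibbs_bounds(4,5)[OF \<mu> gm gD, of s]
  have fpos: "0 < gibbs_density \<mu> f s a" for a
    using fb(1) by (rule less_le_trans[rotated]) simp
  have gpos: "0 < gibbs_density \<mu> g s a" for a
    using gb(1) by (rule less_le_trans[rotated]) simp
  let ?h = "\<lambda>a. gibbs_density \<mu> f s a / gibbs_density \<mu> g s a"
  have eq: "\<pi> s = density (\<pi>' s) (\<lambda>a. ennreal (?h a))"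
    unfolding f g gibbs_policy_def
    using fpos gpos less_imp_neq[OF gpos]
    by (subst density_density_divide) (simp_all add: less_imp_le)
  have prob: "prob_space (\<pi> s)" "prob_space (\<pi>' s)"
    using measurable_space[OF gibbs_policies_kernel[OF \<mu> \<pi>], of s]
      measurable_space[OF gibbs_policies_kernel[OF \<mu> \<pi>'], of s]
    by (auto simp: space_prob_algebra)
  show ?thesis
    unfolding eq
  proof (rule KL_density_finite[where C = "2 * B + 2 * D"])
    show "prob_space (\<pi>' s)" by fact
    show "?h \<in> borel_measurable (\<pi>' s)"
      unfolding g gibbs_policy_def by measurable
    show "exp (- (2 * B + 2 * D)) \<le> ?h a" for a
    proof -
      have "exp (- (2 * B + 2 * D)) = exp (- (2 * B)) / exp (2 * D)"
        by (simp flip: exp_diff)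
      also have "\<dots> \<le> ?h a"
        using fb gb gpos fpos by (intro frac_le) (auto simp: less_imp_le)
      finally show ?thesis .
    qed
    show "?h a \<le> exp (2 * B + 2 * D)" for a
    proof -
      have "?h a \<le> exp (2 * B) / exp (- (2 * D))"
        using fb gb gpos fpos by (intro frac_le) (auto simp: less_imp_le)
      also have "\<dots> = exp (2 * B + 2 * D)"
        by (simp flip: exp_diff)
      finally show ?thesis .
    qed
    show "prob_space (density (\<pi>' s) (\<lambda>a. ennreal (?h a)))"
      using prob(1) unfolding eq .
  qed
qed

lemma reference_in_gibbs_policies:
  fixes \<mu> :: "'a::polish_space measure"
  assumes "\<mu> \<in> space (prob_algebra borel)"
  shows "(\<lambda>_ :: 's::polish_space. \<mu>) \<in> gibbs_policies \<mu>"
proof -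
  interpret prob_space \<mu>
    using assms by (auto simp: space_prob_algebra)
  have "(\<lambda>_ :: 's. \<mu>) = gibbs_policy \<mu> (\<lambda>_. 0)"
    by (simp add: fun_eq_iff gibbs_policy_def gibbs_density_def prob_space density_1)
  then show ?thesis
    unfolding gibbs_policies_def by (intro CollectI exI[of _ "\<lambda>_. 0"]) auto
qed

lemma KL_gibbs_policies_reference_finite:
  assumes "\<mu> \<in> space (prob_algebra borel)" "\<pi> \<in> gibbs_policies \<mu>"
  shows "KL (\<pi> s) \<mu> = ereal (KL_divergence (exp 1) \<mu> (\<pi> s))"
  using KL_gibbs_policies_finite[OF assms reference_in_gibbs_policies[OF assms(1)]] .

lemma Ionescu_Tulcea_step_kernel:
  fixes P :: "'s::polish_space \<times> 'a::polish_space \<Rightarrow> 's measure"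
  assumes P[measurable]: "P \<in> borel \<Otimes>\<^sub>M borel \<rightarrow>\<^sub>M prob_algebra borel"
    and \<pi>[measurable]: "\<pi> \<in> borel \<rightarrow>\<^sub>M prob_algebra borel"
  shows "Ionescu_Tulcea (step_kernel P \<pi> s) (\<lambda>_. borel \<Otimes>\<^sub>M borel)"
proof -
  have "step_kernel P \<pi> s i \<in> PiM {0..<i} (\<lambda>_. borel \<Otimes>\<^sub>M borel) \<rightarrow>\<^sub>M prob_algebra (borel \<Otimes>\<^sub>M borel)" for i
  proof (cases i)
    case 0
    have "return borel s \<in> space (prob_algebra borel)"
      by (simp add: space_prob_algebra prob_space_return)
    then show ?thesis
      unfolding step_kernel_def 0 by simp measurable
  next
    case (Suc k)
    then have [measurable]: "(\<lambda>\<omega>. \<omega> k) \<in> PiM {0..<i} (\<lambda>_. borel \<Otimes>\<^sub>M borel) \<rightarrow>\<^sub>M borel \<Otimes>\<^sub>M borel"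
      by (intro measurable_component_singleton) simp
    then show ?thesis
      unfolding step_kernel_def by (simp add: Suc) measurable
  qed note * = this
  show ?thesis
    unfolding Ionescu_Tulcea_def
  proof (intro conjI allI impI)
    show "step_kernel P \<pi> s i \<in> PiM {0..<i} (\<lambda>_. borel \<Otimes>\<^sub>M borel) \<rightarrow>\<^sub>M subprob_algebra (borel \<Otimes>\<^sub>M borel)" for i
      using * by (rule measurable_prob_algebraD)
    show "prob_space (step_kernel P \<pi> s i x)" if "x \<in> space (PiM {0..<i} (\<lambda>_. borel \<Otimes>\<^sub>M borel))" for i x
      using measurable_space[OF * that] by (simp add: space_prob_algebra)
  qed
qed

lemma state_kernel_pow_kernel:
  fixes P :: "'s::polish_space \<times> 'a::polish_space \<Rightarrow> 's measure"
  assumes P[measurable]: "P \<in> borel \<Otimes>\<^sub>M borel \<rightarrow>\<^sub>M prob_algebra borel"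
    and \<pi>[measurable]: "\<pi> \<in> borel \<rightarrow>\<^sub>M prob_algebra borel"
  shows "state_kernel_pow P \<pi> n \<in> borel \<rightarrow>\<^sub>M prob_algebra borel"
proof -
  have [measurable]: "state_kernel P \<pi> \<in> borel \<rightarrow>\<^sub>M prob_algebra borel"
    unfolding state_kernel_def[abs_def] by measurable
  show ?thesis
  proof (induction n)
    case 0
    then show ?case
      by (simp add: state_kernel_pow.simps(1)[abs_def] cong: measurable_cong)
  next
    case (Suc n)
    from measurable_bind_prob_space[OF Suc \<open>state_kernel P \<pi> \<in> _\<close>] show ?case
      by (simp cong: measurable_cong)
  qed
qed

lemma
  fixes P :: "'s::polish_space \<times> 'a::polish_space \<Rightarrow> 's measure"
  assumes P: "P \<in> borel \<Otimes>\<^sub>M borel \<rightarrow>\<^sub>M prob_algebra borel"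
    and \<pi>: "\<pi> \<in> borel \<rightarrow>\<^sub>M prob_algebra borel"
    and \<gamma>: "0 \<le> \<gamma>" "\<gamma> < 1"
  shows emeasure_occupancy_kernel: "\<And>s B. B \<in> sets borel \<Longrightarrow>
      emeasure (occupancy_kernel P \<gamma> \<pi> s) B
        = ennreal (1 - \<gamma>) * (\<Sum>n. ennreal (\<gamma> ^ n) * emeasure (state_kernel_pow P \<pi> n s) B)"
    and occupancy_kernel_kernel: "occupancy_kernel P \<gamma> \<pi> \<in> borel \<rightarrow>\<^sub>M prob_algebra borel"
proof -
  note k = state_kernel_pow_kernel[OF P \<pi>]
  have sets_k: "sets (state_kernel_pow P \<pi> n s) = sets borel"
    and prob_k: "prob_space (state_kernel_pow P \<pi> n s)" for n s
    using measurable_space[OF k, of s n] by (auto simp: space_prob_algebra)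
  have [measurable]: "state_kernel_pow P \<pi> n \<in> borel \<rightarrow>\<^sub>M subprob_algebra borel" for n
    using k by (rule measurable_prob_algebraD)
  have sets_occ: "sets (occupancy_kernel P \<gamma> \<pi> s) = sets borel" for s
    using sets.sets_measure_of_eq[of "borel :: 's measure"] by (simp add: occupancy_kernel_def)
  show em: "emeasure (occupancy_kernel P \<gamma> \<pi> s) B
      = ennreal (1 - \<gamma>) * (\<Sum>n. ennreal (\<gamma> ^ n) * emeasure (state_kernel_pow P \<pi> n s) B)"
    if B: "B \<in> sets borel" for s B
  proof (rule emeasure_measure_of[OF occupancy_kernel_def])
    let ?m = "\<lambda>B. ennreal (1 - \<gamma>) * (\<Sum>n. ennreal (\<gamma> ^ n) * emeasure (state_kernel_pow P \<pi> n s) B)"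
    show "sets borel \<subseteq> Pow UNIV" by simp
    show "B \<in> sets (occupancy_kernel P \<gamma> \<pi> s)" using B by (simp add: sets_occ)
    show "positive (sets (occupancy_kernel P \<gamma> \<pi> s)) ?m" by (simp add: positive_def)
    show "countably_additive (sets (occupancy_kernel P \<gamma> \<pi> s)) ?m"
      unfolding sets_occ
    proof (rule countably_additiveI)
      fix A :: "nat \<Rightarrow> 's set"
      assume A: "range A \<subseteq> sets borel" "disjoint_family A"
      have swap: "(\<Sum>i. \<Sum>n. h i n) = (\<Sum>n. \<Sum>i. h i n)" for h :: "nat \<Rightarrow> nat \<Rightarrow> ennreal"
        using nn_integral_suminf[of "\<lambda>n i. h i n" "count_space UNIV"]
        by (simp add: nn_integral_count_space_nat)
      have "(\<Sum>i. ?m (A i))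
          = ennreal (1 - \<gamma>) * (\<Sum>n. \<Sum>i. ennreal (\<gamma> ^ n) * emeasure (state_kernel_pow P \<pi> n s) (A i))"
        by (simp add: swap)
      also have "\<dots> = ?m (\<Union>i. A i)"
        using A by (simp add: sets_k suminf_emeasure)
      finally show "(\<Sum>i. ?m (A i)) = ?m (\<Union>i. A i)" .
    qed
  qed
  have "prob_space (occupancy_kernel P \<gamma> \<pi> s)" for s
  proof
    have sp: "emeasure (state_kernel_pow P \<pi> n s) UNIV = 1" for n
      using prob_space.emeasure_space_1[OF prob_k[of n s]] sets_eq_imp_space_eq[OF sets_k[of n s]]
      by simp
    have "(\<Sum>n. ennreal (\<gamma> ^ n)) = ennreal (1 / (1 - \<gamma>))"
      using \<gamma> by (intro suminf_ennreal_eq geometric_sums) auto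
    then have "emeasure (occupancy_kernel P \<gamma> \<pi> s) UNIV = 1"
      using \<gamma> by (simp add: em sp flip: ennreal_mult)
    then show "emeasure (occupancy_kernel P \<gamma> \<pi> s) (space (occupancy_kernel P \<gamma> \<pi> s)) = 1"
      using sets_eq_imp_space_eq[OF sets_occ[of s]] by simp
  qed
  note prob = this
  show "occupancy_kernel P \<gamma> \<pi> \<in> borel \<rightarrow>\<^sub>M prob_algebra borel"
  proof (rule measurable_prob_algebraI[OF prob], rule measurable_subprob_algebra)
    show "subprob_space (occupancy_kernel P \<gamma> \<pi> s)" for s
      using prob by (rule prob_space_imp_subprob_space)
    show "sets (occupancy_kernel P \<gamma> \<pi> s) = sets borel" for s
      by (rule sets_occ)
    fix B :: "'s set" assume B[measurable]: "B \<in> sets borel"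
    show "(\<lambda>s. emeasure (occupancy_kernel P \<gamma> \<pi> s) B) \<in> borel_measurable borel"
      unfolding em[OF B] by measurable
  qed
qed

end

theory Submission
  imports Defs
begin

text \<open>
  Let \<open>T\<close> be the state kernel of \<open>\<pi>\<close>, \<open>v\<close> the value function of \<open>\<pi>'\<close>, and \<open>r\<close> the expected
  regularised one-step cost under \<open>\<pi>\<close>. Writing both policies as \<open>exp l \<mu>\<close> and \<open>exp l' \<mu>\<close> with
  bounded \<open>l, l'\<close>, the relative entropies become integrals of \<open>l\<close> and \<open>l - l'\<close>; together with the
  Bellman equation for \<open>\<pi>'\<close> the bracket in the formula collapses to the Bellman residual
  \<open>r + \<gamma> T v - v\<close>. Against the occupancy kernel, \<open>r\<close> integrates to \<open>1 - \<gamma>\<close> times the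
  value of \<open>\<pi>\<close>, while \<open>\<gamma> T v - v\<close> telescopes to \<open>- (1 - \<gamma>) v\<close>.
\<close>

section \<open>Coordinate marginals of the Ionescu-Tulcea measure\<close>

text \<open>Coordinate \<open>n\<close> is already fixed by the finite stage
  \<open>C 0 (Suc n)\<close>, and the last extension only appends a sample of \<open>P n\<close> to
  a path drawn from \<open>C 0 n\<close>. The first form carries a known marginal over to a finite
  stage; the second exposes the transition that produces the next one.\<close>

lemma (in Ionescu_Tulcea)
  shows distr_lim_component:
      "distr PF.lim (M n) (\<lambda>\<omega>. \<omega> n) = distr (C 0 (Suc n) (\<lambda>_. undefined)) (M n) (\<lambda>\<omega>. \<omega> n)"
    and distr_lim_component_bind:
      "distr PF.lim (M n) (\<lambda>\<omega>. \<omega> n) = C 0 n (\<lambda>_. undefined) \<bind> P n"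
proof -
  let ?u = "\<lambda>_::nat. undefined :: 'a"
  have u: "?u \<in> space (PiM {0..<0} M)" by simp
  \<comment> \<open>\<open>CI {n}\<close> is an image of \<open>C 0 (up_to {n})\<close>; indices
    start at 0, so stage \<open>Suc n\<close> is the first one that contains coordinate
    \<open>n\<close>.\<close>
  have up: "up_to {n} = Suc n"
    by (rule antisym) (auto simp: up_to_iff Suc_le_eq intro: up_to_less)
  have comp_n[measurable]: "(\<lambda>\<omega>. \<omega> n) \<in> PiM {n} M \<rightarrow>\<^sub>M M n"
    by (rule measurable_component_singleton) simp
  have comp[measurable]: "(\<lambda>\<omega>. \<omega> n) \<in> PiM {0..<Suc n} M \<rightarrow>\<^sub>M M n"
    by (rule measurable_component_singleton) simp
  have "distr PF.lim (M n) (\<lambda>\<omega>. \<omega> n)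
      = distr (distr PF.lim (PiM {n} M) (\<lambda>\<omega>. restrict \<omega> {n})) (M n) (\<lambda>\<omega>. \<omega> n)"
    by (subst distr_distr) (auto simp: comp_def measurable_cong_sets[OF PF.sets_lim])
  also have "\<dots> = distr (CI {n}) (M n) (\<lambda>\<omega>. \<omega> n)"
    by (simp add: distr_lim)
  also have "\<dots> = distr (C 0 (Suc n) ?u) (M n) (\<lambda>\<omega>. \<omega> n)"
    unfolding CI_def up using measurable_cong_sets[OF sets_C[OF u, of "Suc n"] refl]
    by (subst distr_distr) (auto simp: comp_def intro!: measurable_restrict simp del: C.simps)
  finally show 1: "distr PF.lim (M n) (\<lambda>\<omega>. \<omega> n) = distr (C 0 (Suc n) ?u) (M n) (\<lambda>\<omega>. \<omega> n)" .
  have eP: "eP n \<in> C 0 n ?u \<rightarrow>\<^sub>M subprob_algebra (PiM {0..<Suc n} M)"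
    by (simp add: measurable_cong_sets[OF sets_C[OF u, of n] refl])
  have "distr (C 0 (Suc n) ?u) (M n) (\<lambda>\<omega>. \<omega> n)
      = C 0 n ?u \<bind> (\<lambda>\<omega>. distr (eP n \<omega>) (M n) (\<lambda>\<omega>. \<omega> n))"
    using prob_space.not_empty[OF prob_space_C[OF u, of n]] by (simp add: distr_bind[OF eP _ comp])
  \<comment> \<open>\<open>eP n \<omega>\<close> is the image of \<open>P n \<omega>\<close> under
    updating \<open>\<omega>\<close> at \<open>n\<close>, so reading coordinate \<open>n\<close>
    undoes the update.\<close>
  also have "\<dots> = C 0 n ?u \<bind> P n"
  proof (rule bind_cong[OF refl])
    fix \<omega> assume "\<omega> \<in> space (C 0 n ?u)"
    then have \<omega>: "\<omega> \<in> space (PiM {0..<n} M)" using space_C[OF u, of n] by simp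
    have m: "fun_upd \<omega> n \<in> P n \<omega> \<rightarrow>\<^sub>M PiM {0..<Suc n} M"
      using \<omega> sets_P[OF \<omega>]
      by (intro measurable_fun_upd[where J="{0..<n}"]) (auto intro: measurable_ident_sets)
    show "distr (eP n \<omega>) (M n) (\<lambda>\<omega>. \<omega> n) = P n \<omega>"
      unfolding eP_def using sets_P[OF \<omega>]
      by (subst distr_distr[OF comp m]) (simp add: comp_def distr_id2)
  qed
  finally show "distr PF.lim (M n) (\<lambda>\<omega>. \<omega> n) = C 0 n ?u \<bind> P n" unfolding 1 .
qed

section \<open>Discounted series and integrals against probability kernels\<close>

lemma summable_norm_discounted:
  fixes b :: "nat \<Rightarrow> real"
  assumes B: "\<And>n. \<bar>b n\<bar> \<le> B" and \<gamma>: "0 \<le> \<gamma>" "\<gamma> < 1"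
  shows "summable (\<lambda>n. norm (\<gamma> ^ n * b n))"
proof (rule summable_comparison_test'[of "\<lambda>n. \<gamma> ^ n * B" 0])
  show "summable (\<lambda>n. \<gamma> ^ n * B)"
    using \<gamma> by (intro summable_mult2 summable_geometric) simp
  show "norm (norm (\<gamma> ^ n * b n)) \<le> \<gamma> ^ n * B" for n
    using B[of n] \<gamma> by (simp add: abs_mult mult_left_mono)
qed

lemma (in prob_space) abs_integral_le_const:
  fixes f :: "'a \<Rightarrow> real"
  assumes "f \<in> borel_measurable M" and B: "\<And>x. \<bar>f x\<bar> \<le> B"
  shows "\<bar>\<integral>x. f x \<partial>M\<bar> \<le> B"
proof -
  have int: "integrable M f"
    using assms by (intro integrable_const_bound[of _ B]) auto
  have "\<bar>\<integral>x. f x \<partial>M\<bar> \<le> (\<integral>x. \<bar>f x\<bar> \<partial>M)"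
    by (rule integral_abs_bound)
  also have "\<dots> \<le> (\<integral>x. B \<partial>M)"
    using int B by (intro integral_mono) auto
  finally show ?thesis by (simp add: prob_space)
qed

text \<open>The bound \<open>B\<close> is uniform in index and point, so the integrated absolute
  values are dominated by \<open>\<gamma> ^ n * B\<close>. This geometric majorant justifies
  exchanging sum and integral.\<close>

lemma integral_discounted_suminf:
  fixes f :: "nat \<Rightarrow> 'b \<Rightarrow> real"
  assumes "prob_space M" and f[measurable]: "\<And>n. f n \<in> borel_measurable M"
    and B: "\<And>n x. \<bar>f n x\<bar> \<le> B" and \<gamma>: "0 \<le> \<gamma>" "\<gamma> < 1"
  shows "(\<integral>x. (\<Sum>n. \<gamma> ^ n * f n x) \<partial>M) = (\<Sum>n. \<gamma> ^ n * (\<integral>x. f n x \<partial>M))"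
proof -
  interpret prob_space M by fact
  have int: "integrable M (f n)" for n
    by (rule integrable_const_bound[of _ B]) (auto simp: B)
  have "summable (\<lambda>n. norm (\<gamma> ^ n * (\<integral>x. \<bar>f n x\<bar> \<partial>M)))"
    by (intro summable_norm_discounted[OF _ \<gamma>, of _ B] abs_integral_le_const) (auto simp: B)
  then have "summable (\<lambda>n. \<integral>x. norm (\<gamma> ^ n * f n x) \<partial>M)"
    using \<gamma> by (simp add: abs_mult)
  then have "(\<integral>x. (\<Sum>n. \<gamma> ^ n * f n x) \<partial>M) = (\<Sum>n. \<integral>x. \<gamma> ^ n * f n x \<partial>M)"
    using int summable_norm_discounted[OF B \<gamma>] by (intro integral_suminf) auto
  then show ?thesis by simp
qed

lemma integral_bind_prob_kernel:
  fixes f :: "'b \<Rightarrow> real"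
  assumes "prob_space M" and k: "k \<in> M \<rightarrow>\<^sub>M prob_algebra N"
    and "f \<in> borel_measurable N" and "\<And>x. \<bar>f x\<bar> \<le> B"
  shows "(\<integral>y. f y \<partial>(M \<bind> k)) = (\<integral>x. (\<integral>y. f y \<partial>k x) \<partial>M)"
proof (rule integral_bind[where K=N and B=B and B'=1])
  interpret prob_space M by fact
  show "finite_measure M" by (rule finite_measure_axioms)
  show "k \<in> M \<rightarrow>\<^sub>M subprob_algebra N" using k by (rule measurable_prob_algebraD)
  show "AE x in M. emeasure (k x) (space (k x)) \<le> ennreal 1"
    using measurable_space[OF k] by (auto simp: space_prob_algebra prob_space.emeasure_space_1)
qed (use assms in auto)

lemma
  fixes k :: "'b \<Rightarrow> 'c measure" and f :: "'c \<Rightarrow> real"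
  assumes k: "k \<in> N \<rightarrow>\<^sub>M prob_algebra L" and f: "f \<in> borel_measurable L"
  shows measurable_kernel_integral: "(\<lambda>x. \<integral>y. f y \<partial>k x) \<in> borel_measurable N"
    and abs_kernel_integral_le: "(\<And>y. \<bar>f y\<bar> \<le> B) \<Longrightarrow> x \<in> space N \<Longrightarrow> \<bar>\<integral>y. f y \<partial>k x\<bar> \<le> B"
proof -
  show "(\<lambda>x. \<integral>y. f y \<partial>k x) \<in> borel_measurable N"
    by (rule measurable_compose[OF measurable_prob_algebraD[OF k] integral_measurable_subprob_algebra[OF f]])
  show "\<bar>\<integral>y. f y \<partial>k x\<bar> \<le> B" if "\<And>y. \<bar>f y\<bar> \<le> B" "x \<in> space N"
  proof -
    have "prob_space (k x)" "f \<in> borel_measurable (k x)"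
      using measurable_space[OF k that(2)] f by (auto simp: space_prob_algebra cong: measurable_cong_sets)
    then show ?thesis using that(1) by (rule prob_space.abs_integral_le_const)
  qed
qed

section \<open>State chain and trajectory marginals of a controlled process\<close>

text \<open>The locale is interpreted at both policies: at the first for its occupancy measure, at
  the second for its Bellman equation.\<close>

locale controlled_process =
  fixes P :: "'s::polish_space \<times> 'a::polish_space \<Rightarrow> 's measure"
    and \<pi> :: "'s \<Rightarrow> 'a measure" and \<gamma> :: real
  assumes P[measurable]: "P \<in> borel \<Otimes>\<^sub>M borel \<rightarrow>\<^sub>M prob_algebra borel"
    and \<pi>[measurable]: "\<pi> \<in> borel \<rightarrow>\<^sub>M prob_algebra borel"
    and \<gamma>: "0 \<le> \<gamma>" "\<gamma> < 1"
begin

abbreviation T :: "'s \<Rightarrow> 's measure" where "T \<equiv> state_kernel P \<pi>"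
abbreviation K :: "nat \<Rightarrow> 's \<Rightarrow> 's measure" where "K \<equiv> state_kernel_pow P \<pi>"

text \<open>This is the final factor of every \<open>step_kernel\<close>: a fresh state is paired
  with an action drawn at that state.\<close>

definition state_action :: "'s \<Rightarrow> ('s \<times> 'a) measure" where
  "state_action s = distr (\<pi> s) (borel \<Otimes>\<^sub>M borel) (Pair s)"

lemma sets_\<pi>[measurable_cong, simp]: "sets (\<pi> s) = sets borel" and prob_\<pi>: "prob_space (\<pi> s)"
  using measurable_space[OF \<pi>, of s] by (auto simp: space_prob_algebra)

lemma state_action_kernel[measurable]: "state_action \<in> borel \<rightarrow>\<^sub>M prob_algebra (borel \<Otimes>\<^sub>M borel)"
  unfolding state_action_def[abs_def] by measurable

lemma state_kernel_kernel[measurable]: "T \<in> borel \<rightarrow>\<^sub>M prob_algebra borel"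
  unfolding state_kernel_def[abs_def] by measurable

lemma K_kernel[measurable]: "K n \<in> borel \<rightarrow>\<^sub>M prob_algebra borel"
  by (rule state_kernel_pow_kernel[OF P \<pi>])

lemma sets_K[measurable_cong, simp]: "sets (K n s) = sets borel" and prob_K: "prob_space (K n s)"
  using measurable_space[OF K_kernel, of s n] by (auto simp: space_prob_algebra)

lemma sets_T[measurable_cong, simp]: "sets (T s) = sets borel" and prob_T: "prob_space (T s)"
  using measurable_space[OF state_kernel_kernel, of s] by (auto simp: space_prob_algebra)

lemma integral_state_action:
  fixes g :: "'s \<times> 'a \<Rightarrow> real"
  assumes [measurable]: "g \<in> borel_measurable (borel \<Otimes>\<^sub>M borel)"
  shows "(\<integral>x. g x \<partial>state_action s) = (\<integral>a. g (s, a) \<partial>\<pi> s)"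
  unfolding state_action_def by (subst integral_distr) auto

lemma state_action_bind: "state_action s \<bind> P = T s"
  unfolding state_action_def state_kernel_def
  by (subst bind_distr[OF _ measurable_prob_algebraD[OF P]])
    (auto simp: prob_space.not_empty[OF prob_\<pi>])

interpretation IT: Ionescu_Tulcea "step_kernel P \<pi> s" "\<lambda>_. borel \<Otimes>\<^sub>M borel" for s
  by (rule Ionescu_Tulcea_step_kernel[OF P \<pi>])

text \<open>Trajectories alternate actions and transitions. Regrouping by associativity of
  \<open>bind\<close> turns each pair of an action and the transition after it into one step of
  \<open>T\<close>, and a single action choice remains at the end.\<close>

lemma distr_trajectory_component:
  "distr (trajectory_measure P \<pi> s) (borel \<Otimes>\<^sub>M borel) (\<lambda>\<omega>. \<omega> n) = K n s \<bind> state_action"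
proof (induction n)
  case 0
  \<comment> \<open>At time 0 the past is the empty path, represented by the constant
    \<open>undefined\<close>, and the step kernel starts from the point mass at
    \<open>s\<close>.\<close>
  have "return (PiM {} (\<lambda>_. borel \<Otimes>\<^sub>M borel)) (\<lambda>_. undefined) \<bind> step_kernel P \<pi> s 0
      = step_kernel P \<pi> s 0 (\<lambda>_. undefined)"
    using IT.P[of s 0] by (intro bind_return) auto
  then show ?case
    unfolding trajectory_measure_def IT.distr_lim_component_bind
    by (simp add: step_kernel_def state_action_def[abs_def])
next
  case (Suc n)
  let ?u = "\<lambda>_::nat. undefined :: 's \<times> 'a"
  let ?C = "\<lambda>m. Ionescu_Tulcea.C (step_kernel P \<pi> s) (\<lambda>_. borel \<Otimes>\<^sub>M borel) 0 m ?u"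
  have u: "?u \<in> space (PiM {0..<0} (\<lambda>_. borel \<Otimes>\<^sub>M borel))" by simp
  have step: "(\<lambda>x. P x \<bind> state_action) \<in> borel \<Otimes>\<^sub>M borel \<rightarrow>\<^sub>M subprob_algebra (borel \<Otimes>\<^sub>M borel)"
    by (rule measurable_prob_algebraD) measurable
  have sub: "T \<in> borel \<rightarrow>\<^sub>M subprob_algebra borel"
    "state_action \<in> borel \<rightarrow>\<^sub>M subprob_algebra (borel \<Otimes>\<^sub>M borel)"
    "P \<in> borel \<Otimes>\<^sub>M borel \<rightarrow>\<^sub>M subprob_algebra borel"
    by (auto intro: measurable_prob_algebraD)
  have sub': "state_action \<in> K n s \<rightarrow>\<^sub>M subprob_algebra (borel \<Otimes>\<^sub>M borel)"
    "T \<in> K n s \<rightarrow>\<^sub>M subprob_algebra borel"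
    using sub by (auto cong: measurable_cong_sets)
  \<comment> \<open>The induction hypothesis concerns the limit measure. Here it is moved to the
    finite stage, on which the next step depends only through coordinate \<open>n\<close>.\<close>
  have marginal: "distr (?C (Suc n)) (borel \<Otimes>\<^sub>M borel) (\<lambda>\<omega>. \<omega> n) = K n s \<bind> state_action"
    using Suc unfolding trajectory_measure_def IT.distr_lim_component .
  have "distr (trajectory_measure P \<pi> s) (borel \<Otimes>\<^sub>M borel) (\<lambda>\<omega>. \<omega> (Suc n))
      = ?C (Suc n) \<bind> step_kernel P \<pi> s (Suc n)"
    unfolding trajectory_measure_def IT.distr_lim_component_bind ..
  also have "\<dots> = ?C (Suc n) \<bind> (\<lambda>\<omega>. P (\<omega> n) \<bind> state_action)"
    by (simp add: step_kernel_def[abs_def] state_action_def[abs_def])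
  also have "\<dots> = distr (?C (Suc n)) (borel \<Otimes>\<^sub>M borel) (\<lambda>\<omega>. \<omega> n) \<bind> (\<lambda>x. P x \<bind> state_action)"
    using prob_space.not_empty[OF IT.prob_space_C[OF u, of s "Suc n"]]
      measurable_cong_sets[OF IT.sets_C[OF u, of s "Suc n"] refl]
    by (intro bind_distr[symmetric, OF _ step]) (auto simp del: IT.C.simps)
  also have "\<dots> = (K n s \<bind> state_action) \<bind> (\<lambda>x. P x \<bind> state_action)"
    unfolding marginal ..
  also have "\<dots> = K n s \<bind> (\<lambda>s'. state_action s' \<bind> (\<lambda>x. P x \<bind> state_action))"
    by (rule bind_assoc[OF sub'(1) step])
  \<comment> \<open>Integrating out the action at time \<open>n\<close> merges
    \<open>state_action\<close> and \<open>P\<close> into \<open>T\<close>.\<close>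
  also have "\<dots> = K n s \<bind> (\<lambda>s'. T s' \<bind> state_action)"
  proof (rule bind_cong[OF refl])
    fix s'
    have "P \<in> state_action s' \<rightarrow>\<^sub>M subprob_algebra borel"
      using sub(3) by (simp add: state_action_def)
    from bind_assoc[OF this sub(2)]
    show "state_action s' \<bind> (\<lambda>x. P x \<bind> state_action) = T s' \<bind> state_action"
      by (simp add: state_action_bind)
  qed
  also have "\<dots> = (K n s \<bind> T) \<bind> state_action"
    by (rule bind_assoc[symmetric, OF sub'(2) sub(2)])
  finally show ?case by simp
qed

text \<open>Image measures keep the total mass, so it suffices that one marginal, here that of time
  0, is a probability measure.\<close>

lemma prob_trajectory: "prob_space (trajectory_measure P \<pi> s)"
proof -
  have "prob_space (distr (trajectory_measure P \<pi> s) (borel \<Otimes>\<^sub>M borel) (\<lambda>\<omega>. \<omega> 0))"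
    unfolding distr_trajectory_component
    using measurable_space[OF measurable_bind_prob_space[OF K_kernel state_action_kernel], of s 0]
    by (simp add: space_prob_algebra)
  then show ?thesis
    by (rule prob_space_distrD[rotated])
      (simp add: trajectory_measure_def measurable_cong_sets[OF IT.PF.sets_lim refl])
qed

text \<open>After sum and expectation are exchanged, each term depends on one coordinate only, whose
  law is known. From here on the sequence space is replaced by the state chain.\<close>

lemma integral_discounted_trajectory:
  fixes g :: "'s \<times> 'a \<Rightarrow> real"
  assumes g[measurable]: "g \<in> borel_measurable (borel \<Otimes>\<^sub>M borel)" and B: "\<And>x. \<bar>g x\<bar> \<le> B"
  shows "(\<integral>\<omega>. (\<Sum>n. \<gamma> ^ n * g (\<omega> n)) \<partial>trajectory_measure P \<pi> s)
    = (\<Sum>n. \<gamma> ^ n * (\<integral>s'. (\<integral>a. g (s', a) \<partial>\<pi> s') \<partial>K n s))"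
proof -
  have comp[measurable]: "(\<lambda>\<omega>. \<omega> n) \<in> trajectory_measure P \<pi> s \<rightarrow>\<^sub>M borel \<Otimes>\<^sub>M borel" for n
    by (simp add: trajectory_measure_def measurable_cong_sets[OF IT.PF.sets_lim refl])
  have "(\<integral>\<omega>. g (\<omega> n) \<partial>trajectory_measure P \<pi> s) = (\<integral>s'. (\<integral>a. g (s', a) \<partial>\<pi> s') \<partial>K n s)" for n
  proof -
    have "(\<integral>\<omega>. g (\<omega> n) \<partial>trajectory_measure P \<pi> s) = (\<integral>x. g x \<partial>(K n s \<bind> state_action))"
      unfolding distr_trajectory_component[symmetric] by (rule integral_distr[symmetric]) measurable
    also have "\<dots> = (\<integral>s'. (\<integral>x. g x \<partial>state_action s') \<partial>K n s)"
      using state_action_kernel by (intro integral_bind_prob_kernel[OF prob_K _ g B]) measurable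
    finally show ?thesis by (simp add: integral_state_action)
  qed
  moreover have "(\<integral>\<omega>. (\<Sum>n. \<gamma> ^ n * g (\<omega> n)) \<partial>trajectory_measure P \<pi> s)
      = (\<Sum>n. \<gamma> ^ n * (\<integral>\<omega>. g (\<omega> n) \<partial>trajectory_measure P \<pi> s))"
    using B by (intro integral_discounted_suminf[OF prob_trajectory _ _ \<gamma>, where B=B]) auto
  ultimately show ?thesis by simp
qed

text \<open>The two forms condition on the last and on the first transition. The first follows the
  recursion defining \<open>K\<close>; the second rests on \<open>T\<close> commuting with its own
  powers.\<close>

lemma integral_K:
  fixes h :: "'s \<Rightarrow> real"
  assumes h[measurable]: "h \<in> borel_measurable borel" and B: "\<And>s. \<bar>h s\<bar> \<le> B"
  shows "(\<integral>s'. h s' \<partial>K (Suc n) s) = (\<integral>s'. (\<integral>s''. h s'' \<partial>T s') \<partial>K n s)"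
    and "(\<integral>s'. h s' \<partial>K (Suc n) s) = (\<integral>s'. (\<integral>s''. h s'' \<partial>K n s') \<partial>T s)"
proof -
  show "(\<integral>s'. h s' \<partial>K (Suc n) s) = (\<integral>s'. (\<integral>s''. h s'' \<partial>T s') \<partial>K n s)"
    by (simp, rule integral_bind_prob_kernel[OF prob_K _ h B]) measurable
  have "K (Suc n) s = T s \<bind> K n"
  proof (induction n)
    case 0
    have "return borel s \<bind> T = T s"
      by (rule bind_return[where N=borel]) (auto intro: measurable_prob_algebraD)
    moreover have "K 0 = return borel"
      by (rule ext) simp
    ultimately show ?case by (simp add: bind_return'')
  next
    case (Suc n)
    have "K n \<in> T s \<rightarrow>\<^sub>M subprob_algebra borel"
      by (rule measurable_prob_algebraD) measurable
    from bind_assoc[OF this measurable_prob_algebraD[OF state_kernel_kernel]] Suc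
    show ?case by simp
  qed
  then show "(\<integral>s'. h s' \<partial>K (Suc n) s) = (\<integral>s'. (\<integral>s''. h s'' \<partial>K n s') \<partial>T s)"
    by (simp only:, intro integral_bind_prob_kernel[OF prob_T _ h B]) measurable
qed

section \<open>Discounted sums along the state chain and the occupancy kernel\<close>

text \<open>This is the resolvent of the chain applied to \<open>h\<close>, that is, the Neumann
  series of the inverse of \<open>I - \<gamma> T\<close>.\<close>

definition discounted :: "('s \<Rightarrow> real) \<Rightarrow> 's \<Rightarrow> real" where
  "discounted h s = (\<Sum>n. \<gamma> ^ n * (\<integral>s'. h s' \<partial>K n s))"

context
  fixes h :: "'s \<Rightarrow> real" and B :: real
  assumes h[measurable]: "h \<in> borel_measurable borel" and B: "\<And>s. \<bar>h s\<bar> \<le> B"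
begin

lemma abs_integral_K_le: "\<bar>\<integral>s'. h s' \<partial>K n s\<bar> \<le> B"
  using abs_kernel_integral_le[OF K_kernel h B] by simp

lemma measurable_integral_K[measurable]: "(\<lambda>s. \<integral>s'. h s' \<partial>K n s) \<in> borel_measurable borel"
  using measurable_kernel_integral[OF K_kernel h] .

lemma summable_discounted_K: "summable (\<lambda>n. \<gamma> ^ n * (\<integral>s'. h s' \<partial>K n s))"
  by (rule summable_norm_cancel[OF summable_norm_discounted[OF abs_integral_K_le \<gamma>]])

lemma measurable_discounted[measurable]: "discounted h \<in> borel_measurable borel"
  unfolding discounted_def[abs_def] by measurable

lemma abs_discounted_le: "\<bar>discounted h s\<bar> \<le> B / (1 - \<gamma>)"
proof -
  have geo: "(\<lambda>n. \<gamma> ^ n * B) sums (1 / (1 - \<gamma>) * B)"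
    using \<gamma> by (intro sums_mult2 geometric_sums) simp
  have bd: "\<bar>\<gamma> ^ n * (\<integral>s'. h s' \<partial>K n s)\<bar> \<le> \<gamma> ^ n * B" for n
    using abs_integral_K_le[of n s] \<gamma> by (simp add: abs_mult mult_left_mono)
  have "summable (\<lambda>n. \<bar>\<gamma> ^ n * (\<integral>s'. h s' \<partial>K n s)\<bar>)"
    using summable_norm_discounted[OF abs_integral_K_le \<gamma>] by simp
  then have "\<bar>discounted h s\<bar> \<le> (\<Sum>n. \<bar>\<gamma> ^ n * (\<integral>s'. h s' \<partial>K n s)\<bar>)"
    "(\<Sum>n. \<bar>\<gamma> ^ n * (\<integral>s'. h s' \<partial>K n s)\<bar>) \<le> (\<Sum>n. \<gamma> ^ n * B)"
    unfolding discounted_def using bd sums_summable[OF geo] by (auto intro!: summable_rabs suminf_le)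
  then show ?thesis using sums_unique[OF geo] by simp
qed

lemma discounted_Suc:
  "discounted h s = h s + \<gamma> * (\<Sum>n. \<gamma> ^ n * (\<integral>s'. h s' \<partial>K (Suc n) s))"
proof -
  have "discounted h s = (\<integral>s'. h s' \<partial>K 0 s) + (\<Sum>n. \<gamma> ^ Suc n * (\<integral>s'. h s' \<partial>K (Suc n) s))"
    unfolding discounted_def
    using suminf_split_head[OF summable_discounted_K[of s]] by (simp del: state_kernel_pow.simps)
  also have "(\<Sum>n. \<gamma> ^ Suc n * (\<integral>s'. h s' \<partial>K (Suc n) s)) = \<gamma> * (\<Sum>n. \<gamma> ^ n * (\<integral>s'. h s' \<partial>K (Suc n) s))"
    by (subst suminf_mult[symmetric])
      (auto simp: mult.assoc simp del: state_kernel_pow.simps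
        intro: summable_norm_cancel summable_norm_discounted[OF abs_integral_K_le \<gamma>])
  finally show ?thesis by (simp add: integral_return)
qed

text \<open>Splitting off the term of time 0 and conditioning the rest on the first transition puts
  \<open>T\<close> outside the resolvent: the policy evaluation equation.\<close>

lemma discounted_Bellman: "discounted h s = h s + \<gamma> * (\<integral>s'. discounted h s' \<partial>T s)"
proof -
  have "(\<integral>s'. discounted h s' \<partial>T s) = (\<Sum>n. \<gamma> ^ n * (\<integral>s'. (\<integral>s''. h s'' \<partial>K n s') \<partial>T s))"
    unfolding discounted_def
    using abs_integral_K_le by (intro integral_discounted_suminf[OF prob_T _ _ \<gamma>]) auto
  then show ?thesis
    using discounted_Suc by (simp only: integral_K(2)[OF h B])
qed

text \<open>Conditioning on the last transition instead puts \<open>T\<close> inside the resolvent.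
  This form drives the telescoping against the occupancy kernel.\<close>

lemma discounted_T: "discounted h s = h s + \<gamma> * discounted (\<lambda>s. \<integral>s'. h s' \<partial>T s) s"
  by (subst discounted_Suc) (simp only: integral_K(1)[OF h B] discounted_def)

lemma integral_occupancy_kernel:
  "(\<integral>s'. h s' \<partial>occupancy_kernel P \<gamma> \<pi> s) = (1 - \<gamma>) * discounted h s"
proof -
  \<comment> \<open>As a mixture of the \<open>K n s\<close> with geometric weights the kernel is a \<open>bind\<close>, so integrals disintegrate.\<close>
  let ?G = "measure_pmf (geometric_pmf (1 - \<gamma>))"
  \<comment> \<open>\<open>geometric_pmf\<close> counts failures from 0, so success probability
    \<open>1 - \<gamma>\<close> yields exactly the occupancy weights.\<close>
  have pmf: "pmf (geometric_pmf (1 - \<gamma>)) n = (1 - \<gamma>) * \<gamma> ^ n" for n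
    using \<gamma> by (simp add: mult.commute)
  have ker: "(\<lambda>n. K n s) \<in> ?G \<rightarrow>\<^sub>M prob_algebra borel"
    by (auto simp: space_prob_algebra prob_K)
  have "occupancy_kernel P \<gamma> \<pi> s = ?G \<bind> (\<lambda>n. K n s)"
  proof (rule measure_eqI)
    have occ: "sets (occupancy_kernel P \<gamma> \<pi> s) = sets borel"
      using measurable_space[OF occupancy_kernel_kernel[OF P \<pi> \<gamma>], of s] by (simp add: space_prob_algebra)
    then show "sets (occupancy_kernel P \<gamma> \<pi> s) = sets (?G \<bind> (\<lambda>n. K n s))"
      by (subst sets_bind[where N=borel]) auto
    fix A assume "A \<in> sets (occupancy_kernel P \<gamma> \<pi> s)"
    then have A: "A \<in> sets borel" using occ by simp
    show "emeasure (occupancy_kernel P \<gamma> \<pi> s) A = emeasure (?G \<bind> (\<lambda>n. K n s)) A"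
      using \<gamma> unfolding emeasure_bind[OF _ measurable_prob_algebraD[OF ker] A, simplified]
        emeasure_occupancy_kernel[OF P \<pi> \<gamma> A]
      by (simp add: nn_integral_measure_pmf nn_integral_count_space_nat pmf ennreal_mult mult.assoc
        del: pmf_geometric)
  qed
  then have "(\<integral>s'. h s' \<partial>occupancy_kernel P \<gamma> \<pi> s) = (\<integral>n. (\<integral>s'. h s' \<partial>K n s) \<partial>?G)"
    using integral_bind_prob_kernel[OF prob_space_measure_pmf ker h B] by simp
  also have "\<dots> = (\<integral>n. pmf (geometric_pmf (1 - \<gamma>)) n * (\<integral>s'. h s' \<partial>K n s) \<partial>count_space UNIV)"
    unfolding measure_pmf_eq_density by (subst integral_density) auto
  also have "\<dots> = (\<Sum>n. (1 - \<gamma>) * (\<gamma> ^ n * (\<integral>s'. h s' \<partial>K n s)))"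
  proof -
    have "norm ((1 - \<gamma>) * \<gamma> ^ n * (\<integral>s'. h s' \<partial>K n s)) = (1 - \<gamma>) * norm (\<gamma> ^ n * (\<integral>s'. h s' \<partial>K n s))" for n
      using \<gamma> by (simp add: abs_mult)
    then have "summable (\<lambda>n. norm ((1 - \<gamma>) * \<gamma> ^ n * (\<integral>s'. h s' \<partial>K n s)))"
      using summable_mult[OF summable_norm_discounted[OF abs_integral_K_le[of _ s] \<gamma>], of "1 - \<gamma>"]
      by (simp only:)
    then show ?thesis
      unfolding pmf by (simp only: integral_count_space_nat integrable_count_space_nat_iff) (simp only: mult.assoc)
  qed
  also have "\<dots> = (1 - \<gamma>) * discounted h s"
    unfolding discounted_def by (rule suminf_mult[OF summable_discounted_K])
  finally show ?thesis .
qed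

end

section \<open>Policy integrals and Bellman residuals under the occupancy measure\<close>

text \<open>In the integral over actions both the measure and the integrand vary with
  \<open>s\<close>. Passing to \<open>state_action\<close> leaves a fixed integrand
  \<open>g\<close>, so measurability of kernel integrals applies.\<close>

lemma
  fixes g :: "'s \<times> 'a \<Rightarrow> real"
  assumes g: "g \<in> borel_measurable (borel \<Otimes>\<^sub>M borel)" and B: "\<And>x. \<bar>g x\<bar> \<le> B"
  shows measurable_policy_integral: "(\<lambda>s. \<integral>a. g (s, a) \<partial>\<pi> s) \<in> borel_measurable borel"
    and abs_policy_integral_le: "\<bar>\<integral>a. g (s, a) \<partial>\<pi> s\<bar> \<le> B"
    and integrable_policy: "integrable (\<pi> s) (\<lambda>a. g (s, a))"
proof -
  note [measurable] = g
  show "(\<lambda>s. \<integral>a. g (s, a) \<partial>\<pi> s) \<in> borel_measurable borel"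
    using measurable_kernel_integral[OF state_action_kernel g] by (simp add: integral_state_action[OF g])
  show "\<bar>\<integral>a. g (s, a) \<partial>\<pi> s\<bar> \<le> B"
    using B by (intro prob_space.abs_integral_le_const[OF prob_\<pi>]) auto
  interpret prob_space "\<pi> s" by (rule prob_\<pi>)
  show "integrable (\<pi> s) (\<lambda>a. g (s, a))"
    by (rule integrable_const_bound[where B=B]) (auto simp: B)
qed

lemma integral_state_kernel:
  fixes h :: "'s \<Rightarrow> real"
  assumes "h \<in> borel_measurable borel" and "\<And>s. \<bar>h s\<bar> \<le> B"
  shows "(\<integral>s'. h s' \<partial>T s) = (\<integral>a. (\<integral>s'. h s' \<partial>P (s, a)) \<partial>\<pi> s)"
  unfolding state_kernel_def
  by (rule integral_bind_prob_kernel[OF prob_\<pi> _ assms]) measurable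

text \<open>With \<open>R\<close> the resolvent, the occupancy kernel integrates as
  \<open>(1 - \<gamma>) R\<close>, and \<open>R v = v + \<gamma> R T v\<close> gives
  \<open>\<gamma> R T v - R v = - v\<close>. Later \<open>v\<close> is the value of the other
  policy, while \<open>T\<close> and the occupancy measure belong to \<open>\<pi>\<close>.\<close>

lemma integral_occupancy_Bellman_residual:
  fixes r v :: "'s \<Rightarrow> real"
  assumes \<rho>: "\<rho> \<in> space (prob_algebra borel)"
    and r[measurable]: "r \<in> borel_measurable borel" and B: "\<And>s. \<bar>r s\<bar> \<le> B"
    and v[measurable]: "v \<in> borel_measurable borel" and D: "\<And>s. \<bar>v s\<bar> \<le> D"
  shows "(\<integral>s. r s + \<gamma> * (\<integral>s'. v s' \<partial>T s) - v s \<partial>occupancy_measure P \<gamma> \<pi> \<rho>)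
    = (1 - \<gamma>) * ((\<integral>s. discounted r s \<partial>\<rho>) - (\<integral>s. v s \<partial>\<rho>))"
proof -
  note occ = occupancy_kernel_kernel[OF P \<pi> \<gamma>]
  have Tv[measurable]: "(\<lambda>s. \<integral>s'. v s' \<partial>T s) \<in> borel_measurable borel"
    by (rule measurable_kernel_integral[OF state_kernel_kernel v])
  have TD: "\<bar>\<integral>s'. v s' \<partial>T s\<bar> \<le> D" for s
    by (rule abs_kernel_integral_le[OF state_kernel_kernel v D]) auto
  have bd: "\<bar>r s + \<gamma> * (\<integral>s'. v s' \<partial>T s) - v s\<bar> \<le> B + D + D" for s
  proof -
    have "\<bar>\<gamma> * (\<integral>s'. v s' \<partial>T s)\<bar> \<le> 1 * D"
      unfolding abs_mult using \<gamma> TD[of s] by (intro mult_mono) auto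
    with B[of s] D[of s] show ?thesis by linarith
  qed
  have \<rho>': "prob_space \<rho>" and [measurable_cong]: "sets \<rho> = sets borel"
    using \<rho> by (auto simp: space_prob_algebra)
  \<comment> \<open>The identity is proved for each initial state first and then integrated over
    \<open>\<rho>\<close>.\<close>
  have fibre: "(\<integral>s. r s + \<gamma> * (\<integral>s'. v s' \<partial>T s) - v s \<partial>occupancy_kernel P \<gamma> \<pi> s0)
      = (1 - \<gamma>) * (discounted r s0 - v s0)" for s0
  proof -
    have "prob_space (occupancy_kernel P \<gamma> \<pi> s0)"
      and [measurable_cong]: "sets (occupancy_kernel P \<gamma> \<pi> s0) = sets borel"
      using measurable_space[OF occ, of s0] by (auto simp: space_prob_algebra)
    then interpret occ: prob_space "occupancy_kernel P \<gamma> \<pi> s0" by simp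
    have "integrable (occupancy_kernel P \<gamma> \<pi> s0) r"
      "integrable (occupancy_kernel P \<gamma> \<pi> s0) v"
      "integrable (occupancy_kernel P \<gamma> \<pi> s0) (\<lambda>s. \<integral>s'. v s' \<partial>T s)"
      by (rule occ.integrable_const_bound[where B=B]; use B in simp)
        (rule occ.integrable_const_bound[where B=D]; use D TD in simp)+
    then have "(\<integral>s. r s + \<gamma> * (\<integral>s'. v s' \<partial>T s) - v s \<partial>occupancy_kernel P \<gamma> \<pi> s0)
        = (1 - \<gamma>) * discounted r s0 + \<gamma> * ((1 - \<gamma>) * discounted (\<lambda>s. \<integral>s'. v s' \<partial>T s) s0)
          - (1 - \<gamma>) * discounted v s0"
      by (simp add: integral_occupancy_kernel[OF r B] integral_occupancy_kernel[OF v D]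
          integral_occupancy_kernel[OF Tv TD])
    \<comment> \<open>Expanding \<open>discounted v s0\<close> cancels the term with
      \<open>T v\<close> and leaves only \<open>- v s0\<close>.\<close>
    also have "\<dots> = (1 - \<gamma>) * (discounted r s0 - v s0)"
      unfolding discounted_T[OF v D, of s0] by (simp add: algebra_simps)
    finally show ?thesis .
  qed
  have "(\<integral>s. r s + \<gamma> * (\<integral>s'. v s' \<partial>T s) - v s \<partial>occupancy_measure P \<gamma> \<pi> \<rho>)
      = (\<integral>s0. (1 - \<gamma>) * (discounted r s0 - v s0) \<partial>\<rho>)"
    unfolding occupancy_measure_def fibre[symmetric]
    by (rule integral_bind_prob_kernel[OF \<rho>' _ _ bd, where N=borel])
      (use occ r v Tv in \<open>auto cong: measurable_cong_sets\<close>)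
  moreover have "integrable \<rho> (discounted r)" "integrable \<rho> v"
  proof -
    interpret \<rho>: prob_space \<rho> by fact
    show "integrable \<rho> (discounted r)"
      using measurable_discounted[OF r B] abs_discounted_le[OF r B]
      by (intro \<rho>.integrable_const_bound[where B="B / (1 - \<gamma>)"]) (auto cong: measurable_cong_sets)
    show "integrable \<rho> v"
      using D by (intro \<rho>.integrable_const_bound[where B=D]) auto
  qed
  ultimately show ?thesis by simp
qed

end

section \<open>Gibbs policies in exponential form and their value functions\<close>

text \<open>The exponent is the logarithm of the normalised density, not the function
  \<open>f\<close> itself. The normalising integral lies between \<open>exp (- B)\<close> and
  \<open>exp B\<close>, so the exponent is bounded by \<open>2 * B\<close>.\<close>

lemma gibbs_policies_log_densityE:
  fixes \<mu> :: "'a::polish_space measure" and \<pi> :: "'s::polish_space \<Rightarrow> 'a measure"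
  assumes \<mu>: "\<mu> \<in> space (prob_algebra borel)" and \<pi>: "\<pi> \<in> gibbs_policies \<mu>"
  obtains l B where "l \<in> borel_measurable (borel \<Otimes>\<^sub>M borel)" "\<And>x. \<bar>l x\<bar> \<le> B"
    "\<And>s. \<pi> s = density \<mu> (\<lambda>a. ennreal (exp (l (s, a))))"
proof -
  obtain f B where f: "\<pi> = gibbs_policy \<mu> f"
    and fm: "f \<in> borel_measurable (borel \<Otimes>\<^sub>M borel)" and fB: "\<And>x. \<bar>f x\<bar> \<le> B"
    using gibbs_policiesE[OF \<pi>] by blast
  note measurable_gibbs_density[OF \<mu> fm, measurable]
  note b = gibbs_bounds(4,5)[OF \<mu> fm fB]
  have pos: "0 < gibbs_density \<mu> f s a" for s a
    using b(1)[of s a] by (rule less_le_trans[rotated]) simp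
  show thesis
  proof
    have "(\<lambda>x. ln ((\<lambda>(s, a). gibbs_density \<mu> f s a) x)) \<in> borel_measurable (borel \<Otimes>\<^sub>M borel)"
      by measurable
    then show "(\<lambda>(s, a). ln (gibbs_density \<mu> f s a)) \<in> borel_measurable (borel \<Otimes>\<^sub>M borel)"
      by (simp add: case_prod_unfold)
    show "\<bar>(\<lambda>(s, a). ln (gibbs_density \<mu> f s a)) x\<bar> \<le> 2 * B" for x
    proof (cases x)
      case (Pair s a)
      have "- (2 * B) \<le> ln (gibbs_density \<mu> f s a)" "ln (gibbs_density \<mu> f s a) \<le> 2 * B"
        using ln_mono[OF b(1)[of s a]] ln_mono[OF b(2)[of s a]] pos[of s a] by simp_all
      then show ?thesis by (simp add: Pair)
    qed
    show "\<pi> s = density \<mu> (\<lambda>a. ennreal (exp ((\<lambda>(s, a). ln (gibbs_density \<mu> f s a)) (s, a))))" for s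
      by (simp add: f gibbs_policy_def pos)
  qed
qed

text \<open>The logarithm of the density ratio is \<open>l - l'\<close>. The choice
  \<open>l' = 0\<close> covers the divergence from the reference measure.\<close>

lemma (in sigma_finite_measure) KL_divergence_density_exp:
  assumes [measurable]: "l \<in> borel_measurable M" "l' \<in> borel_measurable M"
  shows "KL_divergence (exp 1) (density M (\<lambda>x. ennreal (exp (l' x)))) (density M (\<lambda>x. ennreal (exp (l x))))
    = (\<integral>x. l x - l' x \<partial>density M (\<lambda>x. ennreal (exp (l x))))"
  by (subst KL_density_density) (auto simp: integral_density log_def simp flip: exp_diff)

lemma AE_policy_density_exp:
  fixes \<mu> :: "'a::polish_space measure" and \<pi> :: "'s::polish_space \<Rightarrow> 'a measure"
  assumes \<mu>: "\<mu> \<in> space (prob_algebra borel)"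
    and l[measurable]: "l \<in> borel_measurable (borel \<Otimes>\<^sub>M borel)"
    and \<pi>: "\<pi> s = density \<mu> (\<lambda>a. ennreal (exp (l (s, a))))"
  shows "AE a in \<mu>. policy_density \<mu> \<pi> s a = exp (l (s, a))"
proof -
  have [measurable_cong]: "sets \<mu> = sets borel" and "prob_space \<mu>"
    using \<mu> by (auto simp: space_prob_algebra)
  interpret prob_space \<mu> by fact
  have "AE a in \<mu>. ennreal (exp (l (s, a))) = RN_deriv \<mu> (\<pi> s) a"
    by (rule RN_deriv_unique) (auto simp: \<pi>)
  then show ?thesis
    unfolding policy_density_def by eventually_elim (metis enn2real_ennreal exp_ge_zero)
qed


text \<open>The divergence from \<open>\<mu>\<close> is the mean of \<open>l\<close> under the
  policy and depends on the state alone, so averaging the one-step cost over actions gives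
  \<open>r\<close>. Tying \<open>r\<close> to its formula by an equation lets the results be used
  with a locally defined reward.\<close>

lemma
  fixes P :: "'s::polish_space \<times> 'a::polish_space \<Rightarrow> 's measure" and \<pi> :: "'s \<Rightarrow> 'a measure"
    and \<tau> :: real
  assumes P: "P \<in> borel \<Otimes>\<^sub>M borel \<rightarrow>\<^sub>M prob_algebra borel"
    and c[measurable]: "c \<in> borel_measurable (borel \<Otimes>\<^sub>M borel)" and C: "\<And>x. \<bar>c x\<bar> \<le> C"
    and \<gamma>: "0 \<le> \<gamma>" "\<gamma> < 1"
    and \<mu>: "\<mu> \<in> space (prob_algebra borel)" and Gibbs: "\<pi> \<in> gibbs_policies \<mu>"
    and l[measurable]: "l \<in> borel_measurable (borel \<Otimes>\<^sub>M borel)" and B: "\<And>x. \<bar>l x\<bar> \<le> B"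
    and dens: "\<And>s. \<pi> s = density \<mu> (\<lambda>a. ennreal (exp (l (s, a))))"
    and r_def: "r = (\<lambda>s. (\<integral>a. c (s, a) \<partial>\<pi> s) + \<tau> * (\<integral>a. l (s, a) \<partial>\<pi> s))"
  shows measurable_reg_reward: "r \<in> borel_measurable borel"
    and abs_reg_reward_le: "\<bar>r s\<bar> \<le> C + \<bar>\<tau>\<bar> * B"
    and reg_value_eq_discounted: "reg_value P c \<gamma> \<mu> \<tau> \<pi> s = controlled_process.discounted P \<pi> \<gamma> r s"
proof -
  interpret controlled_process P \<pi> \<gamma>
    using P gibbs_policies_kernel[OF \<mu> Gibbs] \<gamma> by unfold_locales
  interpret \<mu>: prob_space \<mu> using \<mu> by (simp add: space_prob_algebra)
  have [measurable_cong]: "sets \<mu> = sets borel" using \<mu> by (simp add: space_prob_algebra)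
  note [measurable] = measurable_policy_integral[OF c C] measurable_policy_integral[OF l B]
  show r: "r \<in> borel_measurable borel"
    unfolding r_def by measurable
  have \<tau>l: "\<bar>\<tau> * (\<integral>a. l (s, a) \<partial>\<pi> s)\<bar> \<le> \<bar>\<tau>\<bar> * B" for s
    unfolding abs_mult by (intro mult_left_mono abs_policy_integral_le[OF l B]) simp
  show bd: "\<bar>r s\<bar> \<le> C + \<bar>\<tau>\<bar> * B" for s
    unfolding r_def using abs_policy_integral_le[OF c C, of s] \<tau>l[of s] by linarith
  let ?g = "\<lambda>x. c x + \<tau> * (\<integral>a. l (fst x, a) \<partial>\<pi> (fst x))"
  have KL: "real_of_ereal (KL (\<pi> s) \<mu>) = (\<integral>a. l (s, a) \<partial>\<pi> s)" for s
    using \<mu>.KL_divergence_density_exp[of "\<lambda>a. l (s, a)" "\<lambda>_. 0"]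
    unfolding KL_gibbs_policies_reference_finite[OF \<mu> Gibbs] by (simp add: dens density_1)
  have "reg_value P c \<gamma> \<mu> \<tau> \<pi> s = (\<integral>\<omega>. (\<Sum>n. \<gamma> ^ n * ?g (\<omega> n)) \<partial>trajectory_measure P \<pi> s)"
    unfolding reg_value_def KL ..
  also have "\<dots> = (\<Sum>n. \<gamma> ^ n * (\<integral>s'. (\<integral>a. ?g (s', a) \<partial>\<pi> s') \<partial>K n s))"
  proof (rule integral_discounted_trajectory)
    show "?g \<in> borel_measurable (borel \<Otimes>\<^sub>M borel)" by measurable
    show "\<bar>?g x\<bar> \<le> C + \<bar>\<tau>\<bar> * B" for x
      using C[of x] \<tau>l[of "fst x"] by linarith
  qed
  \<comment> \<open>The entropy term is constant in the action and is integrated against a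
    probability measure.\<close>
  also have "(\<lambda>s'. \<integral>a. ?g (s', a) \<partial>\<pi> s') = r"
    using integrable_policy[OF c C] prob_space.prob_space[OF prob_\<pi>]
    by (auto simp: r_def fun_eq_iff finite_measure.integrable_const[OF prob_space.finite_measure[OF prob_\<pi>]])
  finally show "reg_value P c \<gamma> \<mu> \<tau> \<pi> s = discounted r s"
    unfolding discounted_def .
qed

section \<open>Assembly of the performance difference formula\<close>

theorem lemma2p3:
  fixes P :: "'s::polish_space \<times> 'a::polish_space \<Rightarrow> 's measure"
    and c :: "'s \<times> 'a \<Rightarrow> real"
    and \<gamma> \<tau> :: real
    and \<mu> :: "'a measure"
    and \<rho> :: "'s measure"
    and \<pi> \<pi>' :: "'s \<Rightarrow> 'a measure"
  assumes "P \<in> borel \<Otimes>\<^sub>M borel \<rightarrow>\<^sub>M prob_algebra borel"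
    and "c \<in> borel_measurable (borel \<Otimes>\<^sub>M borel)" and "bounded (range c)"
    and "0 \<le> \<gamma>" and "\<gamma> < 1" and "0 < \<tau>"
    and "\<mu> \<in> space (prob_algebra borel)"
    and "\<rho> \<in> space (prob_algebra borel)"
    and "\<pi> \<in> gibbs_policies \<mu>" and "\<pi>' \<in> gibbs_policies \<mu>"
  shows "reg_value_dist P c \<gamma> \<mu> \<tau> \<pi> \<rho> - reg_value_dist P c \<gamma> \<mu> \<tau> \<pi>' \<rho> =
    1 / (1 - \<gamma>) *
      (\<integral>s. ((\<integral>a. reg_Q P c \<gamma> \<mu> \<tau> \<pi>' s a + \<tau> * ln (policy_density \<mu> \<pi>' s a) \<partial>\<pi> s)
           - (\<integral>a. reg_Q P c \<gamma> \<mu> \<tau> \<pi>' s a + \<tau> * ln (policy_density \<mu> \<pi>' s a) \<partial>\<pi>' s)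
           + \<tau> * real_of_ereal (KL (\<pi> s) (\<pi>' s)))
        \<partial>occupancy_measure P \<gamma> \<pi> \<rho>)"
proof -
  note P = assms(1) and c[measurable] = assms(2) and \<gamma> = assms(4,5) and \<mu> = assms(7) and \<rho> = assms(8)
    and \<pi> = assms(9) and \<pi>' = assms(10)
  obtain C where C: "\<And>x. \<bar>c x\<bar> \<le> C"
    using \<open>bounded (range c)\<close> unfolding bounded_iff by auto
  obtain l B where l[measurable]: "l \<in> borel_measurable (borel \<Otimes>\<^sub>M borel)" and B: "\<And>x. \<bar>l x\<bar> \<le> B"
    and dens: "\<And>s. \<pi> s = density \<mu> (\<lambda>a. ennreal (exp (l (s, a))))"
    using gibbs_policies_log_densityE[OF \<mu> \<pi>] by blast
  obtain l' B' where l'[measurable]: "l' \<in> borel_measurable (borel \<Otimes>\<^sub>M borel)" and B': "\<And>x. \<bar>l' x\<bar> \<le> B'"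
    and dens': "\<And>s. \<pi>' s = density \<mu> (\<lambda>a. ennreal (exp (l' (s, a))))"
    using gibbs_policies_log_densityE[OF \<mu> \<pi>'] by blast
  interpret p: controlled_process P \<pi> \<gamma>
    using P gibbs_policies_kernel[OF \<mu> \<pi>] \<gamma> by unfold_locales
  interpret p': controlled_process P \<pi>' \<gamma>
    using P gibbs_policies_kernel[OF \<mu> \<pi>'] \<gamma> by unfold_locales
  interpret \<mu>: prob_space \<mu> using \<mu> by (simp add: space_prob_algebra)
  have [measurable_cong]: "sets \<mu> = sets borel" using \<mu> by (simp add: space_prob_algebra)

  define r where "r = (\<lambda>s. (\<integral>a. c (s, a) \<partial>\<pi> s) + \<tau> * (\<integral>a. l (s, a) \<partial>\<pi> s))"
  define r' where "r' = (\<lambda>s. (\<integral>a. c (s, a) \<partial>\<pi>' s) + \<tau> * (\<integral>a. l' (s, a) \<partial>\<pi>' s))"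
  define v where "v = p'.discounted r'"
  note rew = P c C \<gamma> \<mu> \<pi> l B dens and rew' = P c C \<gamma> \<mu> \<pi>' l' B' dens'
  note rm = measurable_reg_reward[OF rew r_def]
    and rb = abs_reg_reward_le[OF rew r_def]
    and rm' = measurable_reg_reward[OF rew' r'_def]
    and rb' = abs_reg_reward_le[OF rew' r'_def]
  have V: "reg_value P c \<gamma> \<mu> \<tau> \<pi> = p.discounted r" "reg_value P c \<gamma> \<mu> \<tau> \<pi>' = v"
    unfolding v_def
    by (rule ext, rule reg_value_eq_discounted[OF rew r_def] reg_value_eq_discounted[OF rew' r'_def])+
  \<comment> \<open>This is the bound on \<open>r'\<close> divided by \<open>1 - \<gamma>\<close>,
    as \<open>abs_discounted_le\<close> provides it.\<close>
  define D where "D = (C + \<bar>\<tau>\<bar> * B') / (1 - \<gamma>)"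
  have v[measurable]: "v \<in> borel_measurable borel" and vD: "\<And>s. \<bar>v s\<bar> \<le> D"
    unfolding v_def D_def
    by (rule p'.measurable_discounted[OF rm' rb'] p'.abs_discounted_le[OF rm' rb'])+
  define w where "w = (\<lambda>x. \<integral>s'. v s' \<partial>P x)"
  have w[measurable]: "w \<in> borel_measurable (borel \<Otimes>\<^sub>M borel)" and wD: "\<And>x. \<bar>w x\<bar> \<le> D"
    unfolding w_def using measurable_kernel_integral[OF P v] abs_kernel_integral_le[OF P v vD]
    by (auto simp: space_pair_measure)

  let ?F = "\<lambda>s a. reg_Q P c \<gamma> \<mu> \<tau> \<pi>' s a + \<tau> * ln (policy_density \<mu> \<pi>' s a)"
  have [measurable]: "policy_density \<mu> \<pi>' s \<in> borel_measurable \<mu>" for s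
    unfolding policy_density_def[abs_def] by measurable
  \<comment> \<open>Stated for a general \<open>q\<close>, since the same integrand is needed under
    \<open>\<pi>\<close> and under \<open>\<pi>'\<close>; the exponent \<open>l'\<close> inside it
    always belongs to \<open>\<pi>'\<close>.\<close>
  have F: "(\<integral>a. ?F s a \<partial>q s)
      = (\<integral>a. c (s, a) \<partial>q s) + \<gamma> * (\<integral>s'. v s' \<partial>state_kernel P q s) + \<tau> * (\<integral>a. l' (s, a) \<partial>q s)"
    if q: "controlled_process P q \<gamma>" and qd: "\<And>s. q s = density \<mu> (\<lambda>a. ennreal (exp (m (s, a))))"
      and m[measurable]: "m \<in> borel_measurable (borel \<Otimes>\<^sub>M borel)" for q m s
  proof -
    interpret q: controlled_process P q \<gamma> by (rule q)
    \<comment> \<open>The density is known only up to a \<open>\<mu>\<close>-null set. As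
      \<open>q s\<close> has a density with respect to \<open>\<mu>\<close>, that set is null for
      \<open>q s\<close> as well.\<close>
    have "AE a in q s. policy_density \<mu> \<pi>' s a = exp (l' (s, a))"
      using AE_policy_density_exp[where \<pi>=\<pi>' and s=s, OF \<mu> l' dens'] unfolding qd by (subst AE_density) auto
    then have ae: "AE a in q s. ?F s a = c (s, a) + \<gamma> * w (s, a) + \<tau> * l' (s, a)"
      by eventually_elim (simp add: reg_Q_def V w_def)
    have "policy_density \<mu> \<pi>' s \<in> borel_measurable (q s)"
      unfolding qd by measurable
    then have "(\<integral>a. ?F s a \<partial>q s) = (\<integral>a. c (s, a) + \<gamma> * w (s, a) + \<tau> * l' (s, a) \<partial>q s)"
      using ae unfolding reg_Q_def V fun_cong[OF w_def, symmetric] by (intro integral_cong_AE) measurable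
    also have "\<dots> = (\<integral>a. c (s, a) \<partial>q s) + \<gamma> * (\<integral>a. w (s, a) \<partial>q s) + \<tau> * (\<integral>a. l' (s, a) \<partial>q s)"
      using q.integrable_policy[OF c C] q.integrable_policy[OF w wD] q.integrable_policy[OF l' B'] by simp
    finally show ?thesis
      unfolding q.integral_state_kernel[OF v vD] w_def .
  qed
  have KL: "real_of_ereal (KL (\<pi> s) (\<pi>' s)) = (\<integral>a. l (s, a) \<partial>\<pi> s) - (\<integral>a. l' (s, a) \<partial>\<pi> s)" for s
    using \<mu>.KL_divergence_density_exp[of "\<lambda>a. l (s, a)" "\<lambda>a. l' (s, a)"]
      p.integrable_policy[OF l B, where s=s] p.integrable_policy[OF l' B', where s=s]
    unfolding KL_gibbs_policies_finite[OF \<mu> \<pi> \<pi>'] by (simp flip: dens dens')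
  \<comment> \<open>The mean of \<open>l'\<close> under \<open>\<pi>\<close> enters once through
    \<open>F\<close> and once, with opposite sign, through \<open>KL\<close>. What remains is the
    mean of \<open>l\<close>, which completes \<open>r\<close>.\<close>
  have "(\<integral>a. ?F s a \<partial>\<pi> s) - (\<integral>a. ?F s a \<partial>\<pi>' s) + \<tau> * real_of_ereal (KL (\<pi> s) (\<pi>' s))
      = r s + \<gamma> * (\<integral>s'. v s' \<partial>state_kernel P \<pi> s) - v s" for s
  proof -
    \<comment> \<open>For \<open>q = \<pi>'\<close> the right side of \<open>F\<close> is
      \<open>r'\<close> plus the discounted mean of \<open>v\<close> at the next state, which is the
      Bellman equation of \<open>\<pi>'\<close>.\<close>
    have "(\<integral>a. ?F s a \<partial>\<pi>' s) = v s"
      using p'.discounted_Bellman[OF rm' rb', where s=s]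
      unfolding F[OF p'.controlled_process_axioms dens' l'] by (simp add: v_def r'_def)
    then show ?thesis
      unfolding F[OF p.controlled_process_axioms dens l] KL by (simp add: r_def algebra_simps)
  qed
  then show ?thesis
    using p.integral_occupancy_Bellman_residual[OF \<rho> rm rb v vD] \<gamma>
    by (simp add: reg_value_dist_def V)
qed

end
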